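(* Let $D$ be the matrix of distances (dissimilarities) $d(\mathfrak{z},\mathfrak{y})$ between $m$ data points, and suppose kernel-$k$-means clustering is pursued by seeking the optimum only among sets of $k$ cluster centers $\boldsymbol{\mu}_1^\Phi,\dots,\boldsymbol{\mu}_k^\Phi$ in which each center may only be equal to $$\boldsymbol{\mu}_j^\Phi=\frac{1}{m_j}\sum_{i\in C_j}\Phi(i)$$ for some subset $C_j$ (of cardinality $m_j$) of all the data points, no other vectors of the feature space being taken into account. Then, after a constant $\sigma$ is added to the distance matrix as follows: $$d'(\mathfrak{z},\mathfrak{y})=\sqrt{d(\mathfrak{z},\mathfrak{y})^2+2\sigma}$$ for distinct data points $\mathfrak{z},\mathfrak{y}$ (with the zero diagonal left unchanged), the optimal clustering will remain the same.
   Context: The data points are labelled $1,\dots,m$; their dissimilarities form a matrix $D$ with zero diagonal which need not be embeddable in a Euclidean space. $\Phi$ denotes the mapping of the data points into the feature space; it is represented only through the kernel matrix $K=(k_{ij})$, whose entries play the role of the dot products $\Phi(i)^T\Phi(j)$, and which is obtained from $D$ by $K=\left(\mathbf{I}-\frac{\mathbf{1}\mathbf{1}^T}{m}\right)\left(-\frac12 D_{sq}\right)\left(\mathbf{I}-\frac{\mathbf{1}\mathbf{1}^T}{m}\right)$, where $D_{sq}$ is the matrix of squared entries of $D$, $\mathbf{1}$ is the all-ones vector and $\mathbf{I}$ the identity matrix. The squared distance of a data point $i$ to the center $\boldsymbol{\mu}_j^\Phi=\frac{1}{m_j}\sum_{h\in C_j}\Phi(h)$ is computed by the "kernel trick": $$\|\Phi(i)-\boldsymbol{\mu}_j^\Phi\|^2=k_{ii}-\frac{2}{m_j}\sum_{h\in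 C_j}k_{hi}+\frac{1}{m_j^2}\sum_{r\in C_j}\sum_{s\in C_j}k_{rs}.$$ Kernel-$k$-means seeks to minimize the cost $$J(\boldsymbol{\mu}_1^\Phi,\dots,\boldsymbol{\mu}_k^\Phi)=\sum_{i=1}^m\min_{1\le j\le k}\|\Phi(i)-\boldsymbol{\mu}_j^\Phi\|^2,$$ the clustering being given by assigning each data point to its closest center. After the change of the distance matrix from $D$ to $D'=(d')$, the kernel matrix and the cost are those computed from $D'$.
   Formalization: As stated this fails for non-Euclidean D. Proved: (1) the claim when the C_j are the k nonempty clusters and each point is charged to its own center; (2) for arbitrary subsets and closest centers, only if σ>0 and some optimum for D consists of the means of its own clusters. *)

theory Defs
  imports "HOL-Analysis.Analysis"
begin

text \<open>The \<open>m\<close> data points are the elements of a finite type \<open>'m\<close>, the \<open>k\<close> cluster labels those of a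
  finite type \<open>'k\<close>, so \<open>m = CARD('m)\<close> and \<open>k = CARD('k)\<close>.\<close>

definition centering :: "real^'m^'m" where
  "centering = mat 1 - (\<chi> i j. 1 / real CARD('m))"

definition kernel_matrix :: "real^'m^'m \<Rightarrow> real^'m^'m" where
  "kernel_matrix D = centering ** (\<chi> i j. - (1/2) * (D $ i $ j)\<^sup>2) ** centering"

definition add_constant :: "real \<Rightarrow> real^'m^'m \<Rightarrow> real^'m^'m" where
  "add_constant \<sigma> D = (\<chi> i j. if i = j then D $ i $ j else sqrt ((D $ i $ j)\<^sup>2 + 2 * \<sigma>))"

text \<open>A centre is given by the nonempty set \<open>S\<close> of data points of which it is the mean; its squared
  distance to a data point is the kernel-trick expression. As \<open>K\<close> need not be positive semidefinite,
  this number can be negative.\<close>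

definition center_dist2 :: "real^'m^'m \<Rightarrow> 'm \<Rightarrow> 'm set \<Rightarrow> real" where
  "center_dist2 K i S = K $ i $ i - 2 / real (card S) * (\<Sum>h\<in>S. K $ h $ i)
     + 1 / (real (card S))\<^sup>2 * (\<Sum>r\<in>S. \<Sum>s\<in>S. K $ r $ s)"

text \<open>A clustering is a map \<open>a\<close> from data points to labels.\<close>

definition clusters :: "('m \<Rightarrow> 'k) \<Rightarrow> 'k \<Rightarrow> 'm set" where
  "clusters a j = {i. a i = j}"

text \<open>Clustering problem: the sets \<open>C\<^sub>j\<close> are the clusters themselves (all \<open>k\<close> of them nonempty, i.e.
  \<open>a\<close> is surjective), and each data point is charged its squared distance to the centre of its own
  cluster.\<close>

definition clustering_cost :: "real^'m^'m \<Rightarrow> ('m \<Rightarrow> 'k) \<Rightarrow> real" where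
  "clustering_cost K a = (\<Sum>i\<in>UNIV. center_dist2 K i (clusters a (a i)))"

definition optimal_clusterings :: "real^'m^'m \<Rightarrow> ('m \<Rightarrow> 'k) set" where
  "optimal_clusterings K =
     {a. surj a \<and> (\<forall>b :: 'm \<Rightarrow> 'k. surj b \<longrightarrow> clustering_cost K a \<le> clustering_cost K b)}"

text \<open>Centre problem: the \<open>k\<close> centres are the means of arbitrary nonempty sets \<open>C j\<close>, which may overlap
  and need not cover the data; each data point is charged its squared distance to a closest centre,
  and a clustering is obtained by assigning every data point to a closest centre. Ties are resolved
  arbitrarily, so one family of centres can yield several clusterings.\<close>

definition J_cost :: "real^'m^'m \<Rightarrow> ('k::finite \<Rightarrow> 'm set) \<Rightarrow> real" where
  "J_cost K C = (\<Sum>i\<in>UNIV. Min (range (\<lambda>j. center_dist2 K i (C j))))"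

definition closest_center :: "real^'m^'m \<Rightarrow> ('k \<Rightarrow> 'm set) \<Rightarrow> ('m \<Rightarrow> 'k) \<Rightarrow> bool" where
  "closest_center K C a \<longleftrightarrow> (\<forall>i l. center_dist2 K i (C (a i)) \<le> center_dist2 K i (C l))"

definition J_optima :: "real^'m^'m \<Rightarrow> (('k::finite \<Rightarrow> 'm set) \<times> ('m \<Rightarrow> 'k)) set" where
  "J_optima K =
     {(C, a). (\<forall>j. C j \<noteq> {}) \<and> (\<forall>B :: 'k \<Rightarrow> 'm set. (\<forall>j. B j \<noteq> {}) \<longrightarrow> J_cost K C \<le> J_cost K B)
        \<and> closest_center K C a}"

end

theory Submission
  imports Defs
begin

text \<open>The change of \<open>D\<close> adds \<open>\<sigma>\<close> times the centering matrix to the kernel matrix, so the squared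
  distance of a data point to the mean of a set \<open>S\<close> grows by \<open>\<sigma> (1 - 1/|S|)\<close> if the point lies in \<open>S\<close>
  and by \<open>\<sigma> (1 + 1/|S|)\<close> otherwise. Hence every clustering into \<open>k\<close> nonempty clusters becomes more
  expensive by exactly \<open>\<sigma> (m - k)\<close>. For arbitrary centres and an arbitrary assignment the increase
  is at least \<open>\<sigma> (m - k)\<close>, with equality only if the sets defining the centres are the clusters.\<close>

section \<open>Effect of the added constant on the kernel matrix\<close>

lemma matrix_sub_ldistrib: "A ** (B - C) = A ** B - A ** (C :: 'a::ring_1^'n^'m)"
  by (simp add: vec_eq_iff matrix_matrix_mult_def right_diff_distrib sum_subtractf)

lemma matrix_add_rdistrib: "(A + B) ** C = A ** C + B ** (C :: 'a::semiring_1^'n^'m)"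
  by (simp add: vec_eq_iff matrix_matrix_mult_def distrib_right sum.distrib)

lemma centering_nth: "(centering :: real^'m^'m) $ i $ j = (if i = j then 1 else 0) - 1 / real CARD('m)"
  by (simp add: centering_def mat_def)

lemma sum_centering_row: "(\<Sum>j\<in>UNIV. (centering :: real^'m^'m) $ i $ j) = 0"
  by (simp add: centering_nth sum_subtractf)

lemma centering_const: "(centering :: real^'m^'m) ** (\<chi> i j. c) = 0"
  by (simp add: vec_eq_iff matrix_matrix_mult_def sum_centering_row flip: sum_distrib_right)

text \<open>\<open>centering\<close> is the orthogonal projection removing the mean: when the right
  factor is split into identity minus constant matrix, the left factor annihilates the constant
  part.\<close>

lemma centering_idem: "(centering :: real^'m^'m) ** centering = centering"
proof -
  have "(centering :: real^'m^'m) ** centering = centering ** (mat 1 - (\<chi> i j. 1 / real CARD('m)))"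
    by (simp add: centering_def)
  also have "\<dots> = centering"
    by (simp add: matrix_sub_ldistrib centering_const)
  finally show ?thesis .
qed

text \<open>Squaring undoes the root, so off the diagonal -1/2 times the squared entry drops by
  \<sigma>. This amounts to adding \<sigma> times the identity and subtracting the constant matrix
  \<sigma>; double centering kills the latter and turns the former into \<sigma> times
  \<open>centering\<close>.\<close>

lemma kernel_matrix_add_constant:
  fixes D :: "real^'m^'m"
  assumes "\<And>i. D $ i $ i = 0" and "\<And>i j. i \<noteq> j \<Longrightarrow> 0 \<le> (D $ i $ j)\<^sup>2 + 2 * \<sigma>"
  shows "kernel_matrix (add_constant \<sigma> D) = kernel_matrix D + \<sigma> *\<^sub>R centering"
proof -
  let ?Q = "(\<chi> i j. - (1/2) * (D $ i $ j)\<^sup>2) :: real^'m^'m"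
  have "(\<chi> i j. - (1/2) * (add_constant \<sigma> D $ i $ j)\<^sup>2) = ?Q + \<sigma> *\<^sub>R mat 1 - (\<chi> i j. \<sigma>)"
    using assms by (auto simp: vec_eq_iff add_constant_def mat_def field_simps)
  moreover have "centering ** (?Q + \<sigma> *\<^sub>R mat 1 - (\<chi> i j. \<sigma>)) ** centering
      = centering ** ?Q ** centering + \<sigma> *\<^sub>R (centering :: real^'m^'m)"
    by (simp add: matrix_sub_ldistrib matrix_add_ldistrib matrix_add_rdistrib centering_const
        matrix_scalar_ac centering_idem flip: scalar_matrix_assoc)
  ultimately show ?thesis
    by (simp add: kernel_matrix_def)
qed

section \<open>Distances to centers under the centering matrix as kernel\<close>

lemma center_dist2_add_scaleR:
  "center_dist2 (K + c *\<^sub>R L) i S = center_dist2 K i S + c * center_dist2 L i S"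
  by (simp add: center_dist2_def sum.distrib algebra_simps flip: sum_distrib_left)

text \<open>\<open>centering\<close> is the Gram matrix of the standard basis vectors after
  subtraction of their common mean. The translation cancels, which leaves the squared distance of a
  basis vector from the mean of those indexed by \<open>S\<close>.\<close>

lemma center_dist2_centering:
  fixes S :: "'m::finite set"
  assumes "S \<noteq> {}"
  shows "center_dist2 (centering :: real^'m^'m) i S = 1 + (if i \<in> S then - 1 else 1) / real (card S)"
proof -
  have c: "real (card S) > 0"
    using assms by (simp add: card_gt_0_iff)
  have row: "(\<Sum>h\<in>S. (centering :: real^'m^'m) $ h $ i)
      = (if i \<in> S then 1 else 0) - real (card S) / real CARD('m)" for i
    by (simp add: centering_nth sum_subtractf)
  \<comment> \<open>The sums are swapped so that the inner one runs over the first index, as in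
    \<open>row\<close>.\<close>
  have "(\<Sum>r\<in>S. \<Sum>s\<in>S. (centering :: real^'m^'m) $ r $ s)
      = (\<Sum>s\<in>S. \<Sum>r\<in>S. (centering :: real^'m^'m) $ r $ s)"
    by (rule sum.swap)
  also have "\<dots> = real (card S) - (real (card S))\<^sup>2 / real CARD('m)"
    by (simp add: row right_diff_distrib power2_eq_square)
  finally have total: "(\<Sum>r\<in>S. \<Sum>s\<in>S. (centering :: real^'m^'m) $ r $ s)
      = real (card S) - (real (card S))\<^sup>2 / real CARD('m)" .
  show ?thesis
    unfolding center_dist2_def row total using assms c
    by (simp add: centering_nth field_simps power2_eq_square)
qed

text \<open>Besides one unit per point, label \<open>j\<close> contributes the points of its cluster
  outside \<open>C j\<close> minus those inside, over \<open>card (C j)\<close>. Counting the latter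
  as \<open>card (C j)\<close> minus the points of \<open>C j\<close> outside the cluster gives -1
  plus the relative size of a symmetric difference. The excess over m - k is thus visibly
  nonnegative.\<close>

lemma sum_center_dist2_centering:
  fixes a :: "'m::finite \<Rightarrow> 'k::finite"
  assumes "\<And>j. C j \<noteq> {}"
  shows "(\<Sum>i\<in>UNIV. center_dist2 (centering :: real^'m^'m) i (C (a i)))
    = real CARD('m) - real CARD('k)
      + (\<Sum>j\<in>UNIV. real (card (C j - clusters a j) + card (clusters a j - C j)) / real (card (C j)))"
proof -
  have inner: "(\<Sum>i\<in>clusters a j. (if i \<in> C j then - 1 else 1) / real (card (C j)))
      = real (card (C j - clusters a j) + card (clusters a j - C j)) / real (card (C j)) - 1" for j
  proof -
    have c: "real (card (C j)) > 0"
      using assms by (simp add: card_gt_0_iff)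
    have "(\<Sum>i\<in>clusters a j. (if i \<in> C j then - 1 else 1 :: real))
        = real (card (clusters a j - C j)) - real (card (clusters a j \<inter> C j))"
      by (simp add: sum.If_cases Diff_eq Collect_neg_eq)
    also have "real (card (clusters a j \<inter> C j)) = real (card (C j)) - real (card (C j - clusters a j))"
      using card_Diff_subset_Int[of "C j" "clusters a j"] card_mono[of "C j" "C j \<inter> clusters a j"]
      by (simp add: Int_commute of_nat_diff)
    finally show ?thesis
      using assms c by (simp add: diff_divide_distrib add_divide_distrib flip: sum_divide_distrib)
  qed
  have "(\<Sum>i\<in>UNIV. center_dist2 (centering :: real^'m^'m) i (C (a i)))
      = real CARD('m) + (\<Sum>i\<in>UNIV. (if i \<in> C (a i) then - 1 else 1) / real (card (C (a i))))"
    by (simp add: center_dist2_centering assms sum.distrib)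
  also have "(\<Sum>i\<in>UNIV. (if i \<in> C (a i) then - 1 else 1) / real (card (C (a i))))
      = (\<Sum>j\<in>UNIV. \<Sum>i\<in>{i \<in> UNIV. a i = j}. (if i \<in> C (a i) then - 1 else 1) / real (card (C (a i))))"
    by (rule sum.group[symmetric]) auto
  also have "\<dots> = (\<Sum>j\<in>UNIV. \<Sum>i\<in>clusters a j. (if i \<in> C j then - 1 else 1) / real (card (C j)))"
    by (simp add: clusters_def)
  also have "\<dots> = (\<Sum>j\<in>UNIV. real (card (C j - clusters a j) + card (clusters a j - C j))
      / real (card (C j))) - real CARD('k)"
    by (simp add: inner sum_subtractf)
  finally show ?thesis
    by simp
qed

lemma sum_center_dist2_centering_ge:
  fixes a :: "'m::finite \<Rightarrow> 'k::finite"
  assumes "\<And>j. C j \<noteq> {}"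
  shows "real CARD('m) - real CARD('k) \<le> (\<Sum>i\<in>UNIV. center_dist2 (centering :: real^'m^'m) i (C (a i)))"
  by (simp add: sum_center_dist2_centering assms sum_nonneg)

text \<open>The excess is a sum of nonnegative terms with nonzero denominators, so it vanishes
  exactly when every symmetric difference is empty.\<close>

lemma sum_center_dist2_centering_eq_iff:
  fixes a :: "'m::finite \<Rightarrow> 'k::finite"
  assumes "\<And>j. C j \<noteq> {}"
  shows "(\<Sum>i\<in>UNIV. center_dist2 (centering :: real^'m^'m) i (C (a i))) = real CARD('m) - real CARD('k)
    \<longleftrightarrow> C = clusters a"
proof -
  have "(\<Sum>i\<in>UNIV. center_dist2 (centering :: real^'m^'m) i (C (a i))) = real CARD('m) - real CARD('k)
      \<longleftrightarrow> (\<forall>j. real (card (C j - clusters a j) + card (clusters a j - C j)) / real (card (C j)) = 0)"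
    by (simp add: sum_center_dist2_centering assms sum_nonneg_eq_0_iff)
  also have "\<dots> \<longleftrightarrow> (\<forall>j. C j = clusters a j)"
    using assms by (simp add: add_nonneg_eq_0_iff) blast
  finally show ?thesis
    by (simp add: fun_eq_iff)
qed

section \<open>The clustering problem\<close>

lemma clusters_nonempty_iff: "(\<forall>j. clusters a j \<noteq> {}) \<longleftrightarrow> surj a"
  unfolding clusters_def surj_def by (simp add: eq_commute)

lemma clustering_cost_add_centering:
  fixes K :: "real^'m^'m" and a :: "'m \<Rightarrow> 'k::finite"
  assumes "surj a"
  shows "clustering_cost (K + \<sigma> *\<^sub>R centering) a
    = clustering_cost K a + \<sigma> * (real CARD('m) - real CARD('k))"
proof -
  have "(\<Sum>i\<in>UNIV. center_dist2 (centering :: real^'m^'m) i (clusters a (a i)))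
      = real CARD('m) - real CARD('k)"
    using sum_center_dist2_centering_eq_iff[of "clusters a" a] clusters_nonempty_iff[of a] assms
    by blast
  then show ?thesis
    by (simp add: clustering_cost_def center_dist2_add_scaleR sum.distrib flip: sum_distrib_left)
qed

text \<open>The increase depends only on m, k and \<sigma>, so all cost comparisons between
  surjective maps persist, for either sign of \<sigma>.\<close>

lemma optimal_clusterings_add_centering:
  fixes K :: "real^'m^'m"
  shows "(optimal_clusterings (K + \<sigma> *\<^sub>R centering) :: ('m \<Rightarrow> 'k::finite) set) = optimal_clusterings K"
  by (auto simp: optimal_clusterings_def clustering_cost_add_centering)

section \<open>The center problem\<close>

lemma J_cost_le:
  fixes a :: "'m::finite \<Rightarrow> 'k::finite"
  shows "J_cost K C \<le> (\<Sum>i\<in>UNIV. center_dist2 K i (C (a i)))"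
  unfolding J_cost_def by (intro sum_mono Min_le) auto

text \<open>Each point is charged at least its minimum, so equal totals force equality at every
  point. This turns being a closest assignment into an equation between costs, which can be obtained
  by squeezing.\<close>

lemma J_cost_eq_iff:
  fixes a :: "'m::finite \<Rightarrow> 'k::finite"
  shows "J_cost K C = (\<Sum>i\<in>UNIV. center_dist2 K i (C (a i))) \<longleftrightarrow> closest_center K C a"
proof
  assume eq: "J_cost K C = (\<Sum>i\<in>UNIV. center_dist2 K i (C (a i)))"
  have "(\<Sum>i\<in>UNIV. center_dist2 K i (C (a i)) - Min (range (\<lambda>j. center_dist2 K i (C j)))) = 0"
    using eq by (simp add: J_cost_def sum_subtractf)
  then have "\<forall>i\<in>UNIV. center_dist2 K i (C (a i)) - Min (range (\<lambda>j. center_dist2 K i (C j))) = 0"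
    by (subst (asm) sum_nonneg_eq_0_iff) (auto intro: Min_le)
  then have "center_dist2 K i (C (a i)) = Min (range (\<lambda>j. center_dist2 K i (C j)))" for i
    by simp
  then show "closest_center K C a"
    by (simp add: closest_center_def)
next
  assume "closest_center K C a"
  then have "Min (range (\<lambda>j. center_dist2 K i (C j))) = center_dist2 K i (C (a i))" for i
    by (intro Min_eqI) (auto simp: closest_center_def)
  then show "J_cost K C = (\<Sum>i\<in>UNIV. center_dist2 K i (C (a i)))"
    by (simp add: J_cost_def)
qed

lemma ex_closest_center:
  fixes C :: "'k::finite \<Rightarrow> 'm::finite set"
  obtains a where "closest_center K C a"
proof -
  have "\<exists>j. \<forall>l. center_dist2 K i (C j) \<le> center_dist2 K i (C l)" for i
    using ex_is_arg_min_if_finite[of "UNIV :: 'k set" "\<lambda>j. center_dist2 K i (C j)"]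
    by (auto simp: is_arg_min_linorder)
  then have "\<exists>a. \<forall>i l. center_dist2 K i (C (a i)) \<le> center_dist2 K i (C l)"
    by metis
  then show thesis
    using that by (auto simp: closest_center_def)
qed

text \<open>The pair given by \<open>a\<^sub>0\<close> minimizes the old cost and the increase at
  once, so the new minimum is the sum of the two minima. Every new optimum must then attain
  both.\<close>

lemma J_optima_add_centering:
  fixes K :: "real^'m^'m" and a\<^sub>0 :: "'m \<Rightarrow> 'k::finite"
  assumes "0 < \<sigma>" and a\<^sub>0: "(clusters a\<^sub>0, a\<^sub>0) \<in> J_optima K"
  shows "(J_optima (K + \<sigma> *\<^sub>R centering) :: (('k \<Rightarrow> 'm set) \<times> ('m \<Rightarrow> 'k)) set)
    = {(C, a). (C, a) \<in> J_optima K \<and> C = clusters a}"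
proof -
  let ?K' = "K + \<sigma> *\<^sub>R centering"
  let ?\<delta> = "\<sigma> * (real CARD('m) - real CARD('k))"
  define J\<^sub>0 where "J\<^sub>0 = J_cost K (clusters a\<^sub>0)"
  have sum': "(\<Sum>i\<in>UNIV. center_dist2 ?K' i (C (a i)))
      = (\<Sum>i\<in>UNIV. center_dist2 K i (C (a i)))
        + \<sigma> * (\<Sum>i\<in>UNIV. center_dist2 (centering :: real^'m^'m) i (C (a i)))"
    for C :: "'k \<Rightarrow> 'm set" and a
    by (simp add: center_dist2_add_scaleR sum.distrib flip: sum_distrib_left)
  have min: "J\<^sub>0 \<le> J_cost K B" if "\<And>j. B j \<noteq> {}" for B :: "'k \<Rightarrow> 'm set"
    using a\<^sub>0 that by (auto simp: J_optima_def J\<^sub>0_def)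
  \<comment> \<open>A closest assignment for the new kernel turns the new cost into an old sum plus
    an increase, and each is bounded below separately.\<close>
  have ge: "J\<^sub>0 + ?\<delta> \<le> J_cost ?K' B" if "\<And>j. B j \<noteq> {}" for B :: "'k \<Rightarrow> 'm set"
  proof -
    obtain b where "closest_center ?K' B b"
      by (rule ex_closest_center)
    then have "J_cost ?K' B = (\<Sum>i\<in>UNIV. center_dist2 ?K' i (B (b i)))"
      by (simp add: J_cost_eq_iff)
    moreover have "J\<^sub>0 \<le> (\<Sum>i\<in>UNIV. center_dist2 K i (B (b i)))"
      using min[of B, OF that] J_cost_le[of K B b] by linarith
    moreover have "?\<delta> \<le> \<sigma> * (\<Sum>i\<in>UNIV. center_dist2 (centering :: real^'m^'m) i (B (b i)))"
      using sum_center_dist2_centering_ge[of B b, OF that] \<open>0 < \<sigma>\<close> by simp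
    ultimately show ?thesis
      using sum'[of B b] by linarith
  qed
  have sum'_clusters: "(\<Sum>i\<in>UNIV. center_dist2 ?K' i (clusters a (a i))) = J\<^sub>0 + ?\<delta>"
    if "(clusters a, a) \<in> J_optima K" for a :: "'m \<Rightarrow> 'k"
  proof -
    have ne: "\<And>j. clusters a j \<noteq> {}" and "closest_center K (clusters a) a"
      and "J_cost K (clusters a) \<le> J\<^sub>0"
      using that a\<^sub>0 unfolding J_optima_def J\<^sub>0_def by blast+
    then have "(\<Sum>i\<in>UNIV. center_dist2 K i (clusters a (a i))) = J\<^sub>0"
      using J_cost_eq_iff[of K "clusters a" a] min[of "clusters a", OF ne] by linarith
    then show ?thesis
      using sum_center_dist2_centering_eq_iff[of "clusters a" a, OF ne] sum'[of "clusters a" a] by simp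
  qed
  have optimum: "(C, a) \<in> J_optima K \<and> C = clusters a" if opt: "(C, a) \<in> J_optima ?K'"
    for C and a :: "'m \<Rightarrow> 'k"
  proof -
    have ne: "\<And>j. C j \<noteq> {}" and "closest_center ?K' C a"
      and le: "J_cost ?K' C \<le> J_cost ?K' (clusters a\<^sub>0)"
      using opt a\<^sub>0 unfolding J_optima_def by blast+
    then have "J_cost ?K' C = (\<Sum>i\<in>UNIV. center_dist2 ?K' i (C (a i)))"
      by (simp add: J_cost_eq_iff)
    moreover have "J_cost ?K' (clusters a\<^sub>0) \<le> J\<^sub>0 + ?\<delta>"
      using J_cost_le[of ?K' "clusters a\<^sub>0" a\<^sub>0] sum'_clusters[OF a\<^sub>0] by linarith
    moreover have "?\<delta> \<le> \<sigma> * (\<Sum>i\<in>UNIV. center_dist2 (centering :: real^'m^'m) i (C (a i)))"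
      using sum_center_dist2_centering_ge[of C a, OF ne] \<open>0 < \<sigma>\<close> by simp
    moreover note le min[of C, OF ne] J_cost_le[of K C a] sum'[of C a]
    \<comment> \<open>The old sum is at least \<open>J\<^sub>0\<close> and the increase at least
      \<open>?\<delta>\<close>, but together they are at most \<open>J\<^sub>0 + ?\<delta>\<close>,
      so equality holds throughout. Cancelling the positive \<sigma> then identifies the sets with
      the clusters.\<close>
    ultimately have J: "J_cost K C = J\<^sub>0" "J_cost K C = (\<Sum>i\<in>UNIV. center_dist2 K i (C (a i)))"
      and "\<sigma> * (\<Sum>i\<in>UNIV. center_dist2 (centering :: real^'m^'m) i (C (a i))) = ?\<delta>"
      by linarith+
    then have "C = clusters a"
      using sum_center_dist2_centering_eq_iff[of C a, OF ne] \<open>0 < \<sigma>\<close> by simp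
    moreover have "(C, a) \<in> J_optima K"
    proof -
      have "closest_center K C a"
        using J(2) by (simp only: J_cost_eq_iff)
      moreover have "\<forall>B :: 'k \<Rightarrow> 'm set. (\<forall>j. B j \<noteq> {}) \<longrightarrow> J_cost K C \<le> J_cost K B"
        unfolding J(1) using min by blast
      ultimately show ?thesis
        unfolding J_optima_def using ne by blast
    qed
    ultimately show ?thesis
      by simp
  qed
  have "(clusters a, a) \<in> J_optima ?K'" if opt: "(clusters a, a) \<in> J_optima K"
    for a :: "'m \<Rightarrow> 'k"
  proof -
    have ne: "\<And>j. clusters a j \<noteq> {}"
      using opt unfolding J_optima_def by blast
    \<comment> \<open>The new cost is squeezed between the general lower bound and the sum for the
      assignment \<open>a\<close>; the resulting equality also makes \<open>a\<close> closest for
      the new kernel.\<close>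
    have J: "J_cost ?K' (clusters a) = J\<^sub>0 + ?\<delta>"
      using J_cost_le[of ?K' "clusters a" a] ge[of "clusters a", OF ne] sum'_clusters[OF opt]
      by linarith
    then have "closest_center ?K' (clusters a) a"
      using sum'_clusters[OF opt] J_cost_eq_iff[of ?K' "clusters a" a] by metis
    moreover have "\<forall>B :: 'k \<Rightarrow> 'm set. (\<forall>j. B j \<noteq> {}) \<longrightarrow> J_cost ?K' (clusters a) \<le> J_cost ?K' B"
      unfolding J using ge by blast
    ultimately show ?thesis
      unfolding J_optima_def using ne by blast
  qed
  with optimum show ?thesis
    by auto
qed

text \<open>The two halves treat the two readings of the center sets: the clusters themselves, or
  arbitrary nonempty sets. As the kernel need not be positive semidefinite, moving a center to the
  mean of its cluster need not lower the cost; hence the second half assumes an old optimum whose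
  sets are its clusters.\<close>

theorem theorem6:
  fixes D :: "real^'m^'m" and \<sigma> :: real
  assumes zero_diagonal: "\<And>i. D $ i $ i = 0"
    and radicand_nonneg: "\<And>i j. i \<noteq> j \<Longrightarrow> 0 \<le> (D $ i $ j)\<^sup>2 + 2 * \<sigma>"
  shows "(optimal_clusterings (kernel_matrix (add_constant \<sigma> D)) :: ('m \<Rightarrow> 'k::finite) set)
           = optimal_clusterings (kernel_matrix D)
       \<and> (0 < \<sigma> \<and> (\<exists>a :: 'm \<Rightarrow> 'k. (clusters a, a) \<in> J_optima (kernel_matrix D)) \<longrightarrow>
            (J_optima (kernel_matrix (add_constant \<sigma> D)) :: (('k \<Rightarrow> 'm set) \<times> ('m \<Rightarrow> 'k)) set)
              = {(C, a). (C, a) \<in> J_optima (kernel_matrix D) \<and> C = clusters a})"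
proof -
  have "kernel_matrix (add_constant \<sigma> D) = kernel_matrix D + \<sigma> *\<^sub>R centering"
    using zero_diagonal radicand_nonneg by (rule kernel_matrix_add_constant)
  then show ?thesis
    using J_optima_add_centering by (auto simp: optimal_clusterings_add_centering)
qed

end
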